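(* Let $\lambda=(n)$ be the frequency $(0,1,2,3,\dots)$. For every $\ell\ge 0$ $$H_{\infty}^{(n)}[\mathrm{Re}>0]=H_{\infty,\ell}^{(n)}[\mathrm{Re}>0]$$ (equality of sets of functions).
   Context: A frequency is a strictly increasing sequence $\lambda=(\lambda_n)$ of non-negative real numbers with $\lambda_n\to\infty$. A $\lambda$-Dirichlet series is a formal series $D=\sum a_n e^{-\lambda_n s}$ with complex coefficients $a_n$. Write $[\mathrm{Re}>\sigma]=\{s\in\mathbb{C}:\mathrm{Re}\,s>\sigma\}$. A $\lambda$-Dirichlet series $D=\sum a_ne^{-\lambda_ns}$ is a $\lambda$-Riesz germ of a holomorphic function $f:[\mathrm{Re}>0]\to\mathbb{C}$ if for some $m\ge 0$ and some $\sigma\ge 0$ one has $f(s)=\lim_{x\to\infty}\sum_{\lambda_n<x}a_ne^{-\lambda_ns}\big(1-\frac{\lambda_n}{x}\big)^m$ for all $s\in[\mathrm{Re}>\sigma]$. For $\ell\ge 0$, $H_{\infty,\ell}^{\lambda}[\mathrm{Re}>0]$ is the linear space of all holomorphic $f:[\mathrm{Re}>0]\to\mathbb{C}$ which have a $\lambda$-Riesz germ and satisfy $\|f\|_{\infty,\ell}=\sup_{\mathrm{Re}\,s>0}\frac{|f(s)|}{(1+|s|)^{\ell}}<\infty$. $H_{\infty}^{\lambda}[\mathrm{Re}>0]$ is the linear space of all bounded holomorphic functions $f:[\mathrm{Re}>0]\to\mathbb{C}$ such that for every $\sigma>0$ the function $t\mapsto f(\sigma+it)$ is uniformly almost periodic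 on $\mathbb{R}$ (i.e. a uniform limit on $\mathbb{R}$ of finite linear combinations of functions $t\mapsto e^{-i\alpha t}$, $\alpha\in\mathbb{R}$), and whose Bohr coefficients $a_x(f)=\lim_{T\to\infty}\frac{1}{2T}\int_{-T}^{T}f(\sigma+it)e^{(\sigma+it)x}\,dt$, $x\in\mathbb{R}$ (which do not depend on the choice of $\sigma>0$), vanish for all $x\notin\{\lambda_n\}$. *)

theory Defs
  imports "HOL-Complex_Analysis.Complex_Analysis"
begin

definition frequency :: "(nat \<Rightarrow> real) \<Rightarrow> bool" where
  "frequency lam \<longleftrightarrow>
     strict_mono lam \<and> (\<forall>n. 0 \<le> lam n) \<and> filterlim lam at_top sequentially"

definition right_half_plane :: "real \<Rightarrow> complex set" where
  "right_half_plane \<sigma> = {s. \<sigma> < Re s}"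

text \<open>
  A formal Dirichlet series with frequency \<open>lam\<close> is represented by its sequence of coefficients.
  If \<open>lam\<close> is a frequency, then the index set of the sum below is finite. There
  \<open>1 - lam n / x\<close> is positive for \<open>x > 0\<close>, so \<open>powr\<close> is the usual real power, and it
  is 1 if \<open>m = 0\<close>.
\<close>

definition riesz_mean ::
  "(nat \<Rightarrow> real) \<Rightarrow> (nat \<Rightarrow> complex) \<Rightarrow> real \<Rightarrow> real \<Rightarrow> complex \<Rightarrow> complex" where
  "riesz_mean lam a m x s =
     (\<Sum>n | lam n < x. a n * exp (- of_real (lam n) * s) * of_real ((1 - lam n / x) powr m))"

definition riesz_germ ::
  "(nat \<Rightarrow> real) \<Rightarrow> (nat \<Rightarrow> complex) \<Rightarrow> (complex \<Rightarrow> complex) \<Rightarrow> bool" where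
  "riesz_germ lam a f \<longleftrightarrow>
     (\<exists>m\<ge>0. \<exists>\<sigma>\<ge>0. \<forall>s\<in>right_half_plane \<sigma>.
        ((\<lambda>x. riesz_mean lam a m x s) \<longlongrightarrow> f s) at_top)"

text \<open>
  Functions on the half-plane \<open>Re s > 0\<close> are represented by total functions; membership in the
  spaces \<open>H_infty_ell\<close> and \<open>H_infty\<close> depends only on the values on that half-plane.
\<close>

definition H_infty_ell :: "(nat \<Rightarrow> real) \<Rightarrow> real \<Rightarrow> (complex \<Rightarrow> complex) set" where
  "H_infty_ell lam l =
     {f. f holomorphic_on right_half_plane 0 \<and>
         (\<exists>a. riesz_germ lam a f) \<and>
         bdd_above ((\<lambda>s. norm (f s) / (1 + norm s) powr l) ` right_half_plane 0)}"

definition trig_polynomial :: "(real \<Rightarrow> complex) \<Rightarrow> bool" where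
  "trig_polynomial p \<longleftrightarrow>
     (\<exists>A c. finite A \<and> p = (\<lambda>t. \<Sum>\<alpha>\<in>A. c \<alpha> * exp (- \<i> * of_real \<alpha> * of_real t)))"

definition uniformly_almost_periodic :: "(real \<Rightarrow> complex) \<Rightarrow> bool" where
  "uniformly_almost_periodic g \<longleftrightarrow>
     (\<exists>P. (\<forall>k. trig_polynomial (P k)) \<and> uniform_limit UNIV P g sequentially)"

text \<open>
  The Bohr coefficient of \<open>f\<close> at \<open>x\<close> is stated as a relation, so that existence of the limit is
  part of it. For the functions in \<open>H_infty\<close> the limit exists and is the same for every
  \<open>\<sigma> > 0\<close>.
\<close>

definition has_bohr_coeff :: "(complex \<Rightarrow> complex) \<Rightarrow> real \<Rightarrow> complex \<Rightarrow> bool" where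
  "has_bohr_coeff f x a \<longleftrightarrow>
     (\<forall>\<sigma>>0. ((\<lambda>T. of_real (1 / (2 * T)) *
                integral {-T..T} (\<lambda>t. f (Complex \<sigma> t) * exp (Complex \<sigma> t * of_real x)))
             \<longlongrightarrow> a) at_top)"

definition H_infty :: "(nat \<Rightarrow> real) \<Rightarrow> (complex \<Rightarrow> complex) set" where
  "H_infty lam =
     {f. f holomorphic_on right_half_plane 0 \<and>
         bounded (f ` right_half_plane 0) \<and>
         (\<forall>\<sigma>>0. uniformly_almost_periodic (\<lambda>t. f (Complex \<sigma> t))) \<and>
         (\<forall>x. x \<notin> range lam \<longrightarrow> has_bohr_coeff f x 0)}"

lemma frequency_of_nat: "frequency (real :: nat \<Rightarrow> real)"
  unfolding frequency_def
  by (auto simp: strict_mono_def filterlim_real_sequentially)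

end

theory Submission
  imports Defs
begin

text \<open>
  Both spaces consist of the functions \<open>f s = F (exp (- s))\<close> with \<open>F\<close> bounded and holomorphic on
  the unit disc. Such a representation follows from \<open>2 \<pi> \<i>\<close>-periodicity and polynomial growth:
  \<open>F\<close> then grows at most like a power of \<open>ln (1 / |z|)\<close> at the origin, so the singularity is
  removable, and \<open>f\<close> is bounded because on \<open>0 < Re s \<le> 1\<close> only a strip of height \<open>2 \<pi>\<close> matters.

  A Riesz germ gives periodicity in a smaller half-plane, hence everywhere by the identity theorem.
  For almost periodic \<open>g t = f (\<sigma> + \<i> t)\<close> whose Bohr coefficients vanish off the integers, all Bohr
  coefficients of \<open>g (t + 2 \<pi>) - g t\<close> vanish, so periodicity reduces to the uniqueness theorem for
  almost periodic functions. That is proved with Bochner--Fejer kernels \<open>K\<close>, the products of Fejer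
  kernels over the frequencies of an approximating trigonometric polynomial \<open>P\<close>: if all Bohr
  coefficients of \<open>u\<close> vanish, then \<open>u K\<close> has mean 0, while the mean of \<open>P K\<close> is close to \<open>P 0\<close>
  times the mean of \<open>K\<close>.
\<close>

section \<open>Bohr means\<close>

text \<open>A relation, so that existence of the limit is part of every statement. For
  \<open>v t = f (Complex \<sigma> t) * cis (x * t)\<close> it yields the Bohr coefficient of
  \<open>f\<close> at \<open>x\<close> up to the factor \<open>exp (\<sigma> * x)\<close>.\<close>

definition has_mean :: "(real \<Rightarrow> complex) \<Rightarrow> complex \<Rightarrow> bool" where
  "has_mean v m \<longleftrightarrow>
     ((\<lambda>T. of_real (1 / (2 * T)) * integral {-T..T} v) \<longlongrightarrow> m) at_top"

lemma integrable_UNIV_continuous: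
  fixes v :: "real \<Rightarrow> 'a::euclidean_space"
  assumes "continuous_on UNIV v"
  shows "v integrable_on {a..b}"
  by (rule integrable_continuous_interval) (rule continuous_on_subset[OF assms], simp)

lemma has_mean_cmult: "has_mean v m \<Longrightarrow> has_mean (\<lambda>t. c * v t) (c * m)"
  unfolding has_mean_def by (drule tendsto_mult_left[where c = c]) (simp add: mult_ac)

lemma has_mean_add:
  assumes "continuous_on UNIV v" "continuous_on UNIV w" "has_mean v m" "has_mean w k"
  shows "has_mean (\<lambda>t. v t + w t) (m + k)"
  using tendsto_add[OF assms(3,4)[unfolded has_mean_def]] assms(1,2)
  unfolding has_mean_def
  by (simp add: integral_add integrable_UNIV_continuous distrib_left)

lemma has_mean_diff:
  assumes "continuous_on UNIV v" "continuous_on UNIV w" "has_mean v m" "has_mean w k"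
  shows "has_mean (\<lambda>t. v t - w t) (m - k)"
  using tendsto_diff[OF assms(3,4)[unfolded has_mean_def]] assms(1,2)
  unfolding has_mean_def
  by (simp add: integral_diff integrable_UNIV_continuous right_diff_distrib)

lemma has_mean_sum:
  assumes "finite I" "\<And>i. i \<in> I \<Longrightarrow> continuous_on UNIV (v i)"
    "\<And>i. i \<in> I \<Longrightarrow> has_mean (v i) (m i)"
  shows "has_mean (\<lambda>t. \<Sum>i\<in>I. v i t) (\<Sum>i\<in>I. m i)"
  using assms
proof (induction I rule: finite_induct)
  case empty
  show ?case by (simp add: has_mean_def)
next
  case (insert i I)
  then show ?case
    by (simp add: has_mean_add continuous_on_sum)
qed

lemma has_mean_zeroI:
  assumes "\<And>T. T > 0 \<Longrightarrow> norm (integral {-T..T} v) \<le> B"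
  shows "has_mean v 0"
  unfolding has_mean_def
proof (rule Lim_null_comparison)
  show "eventually (\<lambda>T. norm (of_real (1 / (2 * T)) * integral {-T..T} v) \<le> 1 / (2 * T) * B) at_top"
    using eventually_gt_at_top[of 0]
  proof eventually_elim
    case (elim T)
    then show ?case
      using mult_left_mono[OF assms[OF elim], of "1 / (2 * T)"] by (simp add: norm_mult norm_divide)
  qed
  show "((\<lambda>T. 1 / (2 * T) * B) \<longlongrightarrow> 0) at_top"
    by real_asymp
qed

lemma has_mean_cis: "has_mean (\<lambda>t. cis (b * t)) (if b = 0 then 1 else 0)"
proof (cases "b = 0")
  case True
  have "eventually (\<lambda>T. of_real (1 / (2 * T)) * integral {-T..T} (\<lambda>t. cis (b * t)) = 1) at_top"
    using eventually_gt_at_top[of 0]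
    by eventually_elim (simp add: True scaleR_conv_of_real)
  then show ?thesis
    using True unfolding has_mean_def by (simp add: tendsto_eventually)
next
  case False
  have "has_mean (\<lambda>t. cis (b * t)) 0"
  proof (rule has_mean_zeroI)
    fix T :: real assume T: "T > 0"
    have "((\<lambda>t. cis (b * t)) has_integral cis (b * T) / (\<i> * b) - cis (b * (-T)) / (\<i> * b)) {-T..T}"
    proof (rule fundamental_theorem_of_calculus)
      fix t assume "t \<in> {-T..T}"
      have "((\<lambda>z. exp (\<i> * b * z) / (\<i> * b)) has_field_derivative exp (\<i> * b * of_real t)) (at (of_real t))"
        using False by (auto intro!: derivative_eq_intros)
      from field_vector_diff_chain_at[OF has_vector_derivative_of_real[OF DERIV_ident] this]
      show "((\<lambda>t. cis (b * t) / (\<i> * b)) has_vector_derivative cis (b * t)) (at t within {-T..T})"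
        by (simp add: cis_conv_exp o_def mult_ac has_vector_derivative_at_within)
    qed (use T in simp)
    then have "norm (integral {-T..T} (\<lambda>t. cis (b * t))) = norm (cis (b * T) / (\<i> * b) - cis (b * (-T)) / (\<i> * b))"
      by (simp add: integral_unique)
    also have "\<dots> \<le> 1 / \<bar>b\<bar> + 1 / \<bar>b\<bar>"
      by (rule order_trans[OF norm_triangle_ineq4]) (simp add: norm_divide norm_mult)
    finally show "norm (integral {-T..T} (\<lambda>t. cis (b * t))) \<le> 1 / \<bar>b\<bar> + 1 / \<bar>b\<bar>" .
  qed
  then show ?thesis using False by simp
qed

text \<open>The integrals of \<open>v\<close> over \<open>{-T..T}\<close> and over its translate
  differ by two end pieces of length \<open>\<bar>a\<bar>\<close>, so the difference stays bounded
  in \<open>T\<close>. The argument works whether or not \<open>v\<close> itself has a mean.\<close>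

lemma has_mean_shift_diff:
  assumes cont: "continuous_on UNIV v" and B: "\<And>t. norm (v t) \<le> B"
  shows "has_mean (\<lambda>t. v (t + a) - v t) 0"
proof (rule has_mean_zeroI)
  fix T :: real assume T: "T > 0"
  \<comment> \<open>The base point does not exceed any of \<open>-T\<close>, \<open>T\<close>,
    \<open>-T + a\<close>, \<open>T + a\<close>, so all integrals below are differences of values of
    one primitive.\<close>
  let ?G = "\<lambda>x. integral {-T - \<bar>a\<bar>..x} v"
  have ii: "v integrable_on {c..d}" for c d by (rule integrable_UNIV_continuous[OF cont])
  have sub: "integral {c..d} v = ?G d - ?G c" if "-T - \<bar>a\<bar> \<le> c" "c \<le> d" for c d
    using Henstock_Kurzweil_Integration.integral_combine[OF that ii] by (simp add: algebra_simps)
  have lip: "norm (?G d - ?G c) \<le> B * \<bar>d - c\<bar>" if "-T - \<bar>a\<bar> \<le> c" "-T - \<bar>a\<bar> \<le> d" for c d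
  proof -
    have "norm (integral {c..d} v) \<le> B * (d - c)" if "c \<le> d" for c d
      using integral_bound[OF that continuous_on_subset[OF cont]] B by auto
    then show ?thesis
      using that sub[of c d] sub[of d c] norm_minus_commute[of "?G c" "?G d"]
      by (cases "c \<le> d") (metis abs_of_nonneg diff_ge_0_iff_ge,
        metis abs_minus_commute abs_of_nonneg diff_ge_0_iff_ge linorder_le_cases)
  qed
  have "integral {-T..T} (\<lambda>t. v (t + a)) = integral {-T + a..T + a} v"
    using integral_shift[of "-T" a T v] continuous_on_subset[OF cont] by (simp add: o_def)
  moreover have "continuous_on UNIV (\<lambda>t. v (t + a))"
    by (intro continuous_on_compose2[OF cont] continuous_intros) auto
  ultimately have "integral {-T..T} (\<lambda>t. v (t + a) - v t) =
      (?G (T + a) - ?G (-T + a)) - (?G T - ?G (-T))"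
    using T sub[of "-T + a" "T + a"] sub[of "-T" T] ii
    by (simp add: integral_diff integrable_UNIV_continuous)
  also have "\<dots> = (?G (T + a) - ?G T) - (?G (-T + a) - ?G (-T))" by simp
  also have "norm \<dots> \<le> B * \<bar>a\<bar> + B * \<bar>a\<bar>"
    using lip[of T "T + a"] lip[of "-T" "-T + a"] T
    by (intro order_trans[OF norm_triangle_ineq4 add_mono]) auto
  finally show "norm (integral {-T..T} (\<lambda>t. v (t + a) - v t)) \<le> B * \<bar>a\<bar> + B * \<bar>a\<bar>" .
qed

lemma has_mean_shift:
  assumes cont: "continuous_on UNIV v" and B: "\<And>t. norm (v t) \<le> B" and "has_mean v m"
  shows "has_mean (\<lambda>t. v (t + a)) m"
proof -
  have "continuous_on UNIV (\<lambda>t. v (t + a))"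
    by (intro continuous_on_compose2[OF cont] continuous_intros) auto
  then have "has_mean (\<lambda>t. (v (t + a) - v t) + v t) (0 + m)"
    by (intro has_mean_add has_mean_shift_diff[OF cont B] assms continuous_intros)
  then show ?thesis by simp
qed

text \<open>Replacing \<open>v\<close> by \<open>P k\<close> changes the normalised integral by at
  most the uniform distance, whatever \<open>T\<close> is; so \<open>k\<close> can be fixed before
  \<open>T\<close> grows.\<close>

lemma has_mean_uniform_limit_zero:
  assumes P: "\<And>k. continuous_on UNIV (P k)" "\<And>k. has_mean (P k) 0"
    and lim: "uniform_limit UNIV P v sequentially"
  shows "has_mean v 0"
  unfolding has_mean_def
proof (rule tendstoI)
  fix e :: real assume e: "e > 0"
  have cont: "continuous_on UNIV v"
    by (rule uniform_limit_theorem[OF _ lim]) (auto simp: P)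
  from e have "eventually (\<lambda>k. \<forall>t\<in>UNIV. dist (P k t) (v t) < e / 2) sequentially"
    using lim by (intro uniform_limitD) auto
  then obtain k where k: "\<And>t. dist (P k t) (v t) < e / 2"
    by (metis (lifting) UNIV_I eventually_sequentially order_refl)
  have "eventually (\<lambda>T. dist (of_real (1 / (2 * T)) * integral {-T..T} (P k)) 0 < e / 2) at_top"
    using P(2)[of k] e unfolding has_mean_def by (intro tendstoD) auto
  then show "eventually (\<lambda>T. dist (of_real (1 / (2 * T)) * integral {-T..T} v) 0 < e) at_top"
    using eventually_gt_at_top[of 0]
  proof eventually_elim
    case (elim T)
    have "norm (integral {-T..T} (\<lambda>t. v t - P k t)) \<le> e / 2 * (T - (-T))"
      using k elim cont P(1)[of k]
      by (intro integral_bound continuous_intros)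
         (auto simp: dist_norm norm_minus_commute less_imp_le intro: continuous_on_subset)
    then have *: "norm (of_real (1 / (2 * T)) * integral {-T..T} (\<lambda>t. v t - P k t)) \<le> e / 2"
      using elim by (simp add: norm_mult norm_divide field_simps)
    have "of_real (1 / (2 * T)) * integral {-T..T} v =
       of_real (1 / (2 * T)) * integral {-T..T} (\<lambda>t. v t - P k t) + of_real (1 / (2 * T)) * integral {-T..T} (P k)"
      using cont P(1) by (simp add: integral_diff integrable_UNIV_continuous distrib_left right_diff_distrib)
    then show ?case
      using * elim(1) norm_triangle_ineq[of "of_real (1 / (2 * T)) * integral {-T..T} (\<lambda>t. v t - P k t)"
        "of_real (1 / (2 * T)) * integral {-T..T} (P k)"]
      by (simp add: dist_norm)
  qed
qed

section \<open>Bochner--Fejer kernels\<close>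

text \<open>The Fejer kernel as a normalised squared modulus, which makes nonnegativity immediate.
  For \<open>n > 0\<close> the function \<open>fejer n (\<alpha> * t)\<close> of \<open>t\<close>
  has mean 1 if \<open>\<alpha> \<noteq> 0\<close>, and mean \<open>n\<close> if
  \<open>\<alpha> = 0\<close>.\<close>

definition fejer :: "nat \<Rightarrow> real \<Rightarrow> real" where
  "fejer n \<theta> = (norm (\<Sum>k<n. cis (real k * \<theta>)))\<^sup>2 / real n"

lemma fejer_nonneg: "fejer n \<theta> \<ge> 0"
  by (simp add: fejer_def)

lemma continuous_on_fejer: "continuous_on UNIV (\<lambda>t. fejer n (a * t))"
  unfolding fejer_def divide_inverse by (intro continuous_intros)

lemma fejer_eq_sum:
  "complex_of_real (fejer n \<theta>) = (\<Sum>j<n. \<Sum>k<n. cis ((real j - real k) * \<theta>)) / of_nat n"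
proof -
  have "complex_of_real ((norm (\<Sum>k<n. cis (real k * \<theta>)))\<^sup>2) =
      (\<Sum>j<n. cis (real j * \<theta>)) * (\<Sum>k<n. cis (- (real k * \<theta>)))"
    unfolding complex_norm_square by (simp add: cis_cnj)
  then show ?thesis
    by (simp add: fejer_def sum_product cis_mult left_diff_distrib)
qed

text \<open>The factor \<open>1 - cis \<theta>\<close> telescopes the geometric sum to
  \<open>1 - cis \<theta> ^ n\<close>, of modulus at most 2. This expresses that the kernel
  concentrates where \<open>cis \<theta>\<close> is near 1.\<close>

lemma norm_one_minus_cis_sq_fejer_le:
  "(norm (1 - cis \<theta>))\<^sup>2 * fejer n \<theta> \<le> 4 / real n"
proof -
  have "(\<Sum>k<n. cis (real k * \<theta>)) = (\<Sum>k<n. cis \<theta> ^ k)"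
    by (intro sum.cong) (simp_all only: Complex.DeMoivre)
  then have "(1 - cis \<theta>) * (\<Sum>k<n. cis (real k * \<theta>)) = 1 - cis \<theta> ^ n"
    by (simp only: one_diff_power_eq)
  then have "norm (1 - cis \<theta>) * norm (\<Sum>k<n. cis (real k * \<theta>)) = norm (1 - cis \<theta> ^ n)"
    by (metis norm_mult)
  also have "\<dots> \<le> 2"
    using norm_triangle_ineq4[of 1 "cis \<theta> ^ n"] by (simp add: norm_power)
  finally have "(norm (1 - cis \<theta>) * norm (\<Sum>k<n. cis (real k * \<theta>)))\<^sup>2 \<le> 2\<^sup>2"
    by (intro power_mono) auto
  then show ?thesis
    by (simp add: fejer_def power_mult_distrib divide_right_mono)
qed

text \<open>By \<open>fejer_eq_sum\<close> the kernel is a trigonometric polynomial with frequencies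
  \<open>(j - k) * \<alpha>\<close>, so multiplication by it adds up shifted coefficients with
  nonnegative weights. Treating all \<open>\<beta>\<close> at once allows iteration over the factors
  of a product.\<close>

lemma has_mean_mult_fejer:
  assumes "continuous_on UNIV v" "\<And>\<beta>. has_mean (\<lambda>t. v t * cis (\<beta> * t)) (m \<beta>)"
  shows "has_mean (\<lambda>t. v t * of_real (fejer n (\<alpha> * t)) * cis (\<beta> * t))
     ((\<Sum>j<n. \<Sum>k<n. m (\<beta> + (real j - real k) * \<alpha>)) / of_nat n)"
proof -
  have "has_mean (\<lambda>t. inverse (of_nat n) * (\<Sum>j<n. \<Sum>k<n. v t * cis ((\<beta> + (real j - real k) * \<alpha>) * t)))
     (inverse (of_nat n) * (\<Sum>j<n. \<Sum>k<n. m (\<beta> + (real j - real k) * \<alpha>)))"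
    by (intro has_mean_cmult has_mean_sum assms continuous_intros) auto
  moreover have *: "v t * cis ((\<beta> + x * \<alpha>) * t) = v t * cis (\<beta> * t) * cis (x * (\<alpha> * t))" for x t
    by (simp add: cis_mult distrib_right mult.assoc)
  have "inverse (of_nat n) * (\<Sum>j<n. \<Sum>k<n. v t * cis ((\<beta> + (real j - real k) * \<alpha>) * t)) =
      v t * of_real (fejer n (\<alpha> * t)) * cis (\<beta> * t)" for t
    unfolding fejer_eq_sum * sum_distrib_left[symmetric] by (simp add: field_simps)
  ultimately show ?thesis
    by (simp add: divide_inverse mult.commute)
qed

definition fejer_prod :: "nat \<Rightarrow> real set \<Rightarrow> real \<Rightarrow> real" where
  "fejer_prod n A t = (\<Prod>\<alpha>\<in>A. fejer n (\<alpha> * t))"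

lemma fejer_prod_nonneg: "fejer_prod n A t \<ge> 0"
  by (simp add: fejer_prod_def prod_nonneg fejer_nonneg)

lemma continuous_on_fejer_prod: "continuous_on UNIV (fejer_prod n A)"
  unfolding fejer_prod_def by (intro continuous_intros continuous_on_fejer)

lemma fejer_prod_insert:
  "finite A \<Longrightarrow> \<alpha> \<notin> A \<Longrightarrow>
    fejer_prod n (insert \<alpha> A) t = fejer_prod n A t * fejer n (\<alpha> * t)"
  by (simp add: fejer_prod_def mult.commute)

lemma has_mean_zero_mult_fejer_prod:
  assumes "finite A" "continuous_on UNIV u" "\<And>\<beta>. has_mean (\<lambda>t. u t * cis (\<beta> * t)) 0"
  shows "has_mean (\<lambda>t. u t * of_real (fejer_prod n A t) * cis (\<beta> * t)) 0"
  using assms(1)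
proof (induction A arbitrary: \<beta> rule: finite_induct)
  case empty
  then show ?case using assms(3) by (simp add: fejer_prod_def)
next
  case (insert \<alpha> A)
  have "continuous_on UNIV (\<lambda>t. u t * of_real (fejer_prod n A t))"
    by (intro continuous_intros assms continuous_on_fejer_prod)
  from has_mean_mult_fejer[OF this insert.IH] show ?case
    using insert.hyps by (simp add: fejer_prod_insert mult.assoc)
qed

text \<open>The new coefficients are nonnegative combinations of the old ones. At 0 the
  \<open>n\<close> diagonal terms \<open>j = k\<close>, divided by \<open>n\<close>, already
  contribute \<open>m 0\<close>.\<close>

lemma has_mean_fejer_step:
  assumes n: "n > 0" and A: "finite A" "\<alpha> \<notin> A" and m: "\<And>\<beta>. m \<beta> \<ge> 0"
    "\<And>\<beta>. has_mean (\<lambda>t. of_real (fejer_prod n A t) * cis (\<beta> * t)) (complex_of_real (m \<beta>))"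
  obtains m' where "\<And>\<beta>. m' \<beta> \<ge> 0" "m' 0 \<ge> m 0"
    "\<And>\<beta>. has_mean (\<lambda>t. of_real (fejer_prod n (insert \<alpha> A) t) * cis (\<beta> * t)) (complex_of_real (m' \<beta>))"
proof
  let ?m' = "\<lambda>\<beta>. (\<Sum>j<n. \<Sum>k<n. m (\<beta> + (real j - real k) * \<alpha>)) / n"
  show "?m' \<beta> \<ge> 0" for \<beta>
    by (intro divide_nonneg_nonneg sum_nonneg m) auto
  have "real n * m 0 = (\<Sum>j<n. m (0 + (real j - real j) * \<alpha>))" by simp
  also have "\<dots> \<le> (\<Sum>j<n. \<Sum>k<n. m (0 + (real j - real k) * \<alpha>))"
    by (intro sum_mono member_le_sum[where f = "\<lambda>k. m (0 + (real _ - real k) * \<alpha>)"] m) auto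
  finally show "?m' 0 \<ge> m 0"
    using n by (simp add: field_simps)
  have "continuous_on UNIV (\<lambda>t. complex_of_real (fejer_prod n A t))"
    by (intro continuous_intros continuous_on_fejer_prod)
  from has_mean_mult_fejer[OF this m(2)]
  show "has_mean (\<lambda>t. of_real (fejer_prod n (insert \<alpha> A) t) * cis (\<beta> * t)) (complex_of_real (?m' \<beta>))" for \<beta>
    using A by (simp add: fejer_prod_insert)
qed

text \<open>The empty product is 1, and no further factor lowers the coefficient at 0. Rational
  relations between the frequencies can push the mean above 1, so only a lower bound is
  kept.\<close>

lemma has_mean_fejer_prod:
  assumes "finite A" "n > 0"
  shows "\<exists>m. (\<forall>\<beta>. m \<beta> \<ge> 0 \<and>
      has_mean (\<lambda>t. of_real (fejer_prod n A t) * cis (\<beta> * t)) (complex_of_real (m \<beta>))) \<and> m 0 \<ge> 1"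
  using assms(1)
proof (induction A rule: finite_induct)
  case empty
  have "has_mean (\<lambda>t. of_real (fejer_prod n {} t) * cis (\<beta> * t)) (complex_of_real (if \<beta> = 0 then 1 else 0))" for \<beta>
    using has_mean_cis[of \<beta>] by (auto simp: fejer_prod_def)
  then show ?case
    by (intro exI[of _ "\<lambda>\<beta>. if \<beta> = 0 then 1 else 0"]) auto
next
  case (insert \<alpha> A)
  then obtain m where m: "\<And>\<beta>. m \<beta> \<ge> 0" "m 0 \<ge> 1"
    "\<And>\<beta>. has_mean (\<lambda>t. of_real (fejer_prod n A t) * cis (\<beta> * t)) (complex_of_real (m \<beta>))"
    by blast
  obtain m' where m': "\<And>\<beta>. m' \<beta> \<ge> 0" "m' 0 \<ge> m 0"
    "\<And>\<beta>. has_mean (\<lambda>t. of_real (fejer_prod n (insert \<alpha> A) t) * cis (\<beta> * t)) (complex_of_real (m' \<beta>))"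
    using has_mean_fejer_step[OF assms(2) insert.hyps m(1,3)] by blast
  show ?case
    using m(2) m' order_trans by blast
qed

text \<open>\<open>M' \<alpha> \<le> M\<close> because the Bohr coefficients of all these kernels are nonnegative.\<close>

lemma has_mean_fejer_prod_remove:
  assumes A: "finite A" and n: "n > 0"
  obtains M M' where "M \<ge> 1" "\<And>\<alpha>. \<alpha> \<in> A \<Longrightarrow> M' \<alpha> \<le> M"
    "has_mean (\<lambda>t. of_real (fejer_prod n A t)) (complex_of_real M)"
    "\<And>\<alpha>. \<alpha> \<in> A \<Longrightarrow> has_mean (\<lambda>t. of_real (fejer_prod n (A - {\<alpha>}) t)) (complex_of_real (M' \<alpha>))"
proof -
  obtain m where m: "m 0 \<ge> 1"
    "\<And>\<beta>. has_mean (\<lambda>t. of_real (fejer_prod n A t) * cis (\<beta> * t)) (complex_of_real (m \<beta>))"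
    using has_mean_fejer_prod[OF A n] by blast
  have "\<exists>x \<le> m 0. has_mean (\<lambda>t. of_real (fejer_prod n (A - {\<alpha>}) t)) (complex_of_real x)"
    if "\<alpha> \<in> A" for \<alpha>
  proof -
    obtain k where k: "\<And>\<beta>. k \<beta> \<ge> 0"
      "\<And>\<beta>. has_mean (\<lambda>t. of_real (fejer_prod n (A - {\<alpha>}) t) * cis (\<beta> * t)) (complex_of_real (k \<beta>))"
      using has_mean_fejer_prod[of "A - {\<alpha>}" n] A n by blast
    obtain k' where k': "k' 0 \<ge> k 0"
      "\<And>\<beta>. has_mean (\<lambda>t. of_real (fejer_prod n (insert \<alpha> (A - {\<alpha>})) t) * cis (\<beta> * t)) (complex_of_real (k' \<beta>))"
      by (rule has_mean_fejer_step[OF n _ _ k, of \<alpha>]) (use A in auto)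
    \<comment> \<open>Adjoining the removed factor gives back the kernel over \<open>A\<close>, so
      both numbers are the mean of the same function.\<close>
    have "complex_of_real (k' 0) = complex_of_real (m 0)"
      using k'(2)[of 0] m(2)[of 0] unfolding has_mean_def insert_Diff[OF that]
      by (rule tendsto_unique[OF trivial_limit_at_top_linorder])
    then show ?thesis
      using k' k(2)[of 0] by auto
  qed
  then obtain M' where "\<And>\<alpha>. \<alpha> \<in> A \<Longrightarrow> M' \<alpha> \<le> m 0"
    "\<And>\<alpha>. \<alpha> \<in> A \<Longrightarrow> has_mean (\<lambda>t. of_real (fejer_prod n (A - {\<alpha>}) t)) (complex_of_real (M' \<alpha>))"
    by metis
  then show ?thesis
    using that[of "m 0" M'] m(1) m(2)[of 0] by auto
qed

section \<open>Uniqueness for almost periodic functions\<close>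

lemma has_mean_norm_le:
  assumes cont: "continuous_on UNIV v" "continuous_on UNIV k"
    and le: "\<And>t. norm (v t) \<le> k t"
    and mean: "has_mean v m" "has_mean (\<lambda>t. complex_of_real (k t)) (of_real \<kappa>)"
  shows "norm m \<le> \<kappa>"
proof (rule tendsto_le[OF trivial_limit_at_top_linorder])
  show "((\<lambda>T. norm (of_real (1 / (2 * T)) * integral {-T..T} v)) \<longlongrightarrow> norm m) at_top"
    using mean(1) unfolding has_mean_def by (rule tendsto_norm)
  have "integral {-T..T} (\<lambda>t. complex_of_real (k t)) = of_real (integral {-T..T} k)" for T
    using integral_linear[OF integrable_UNIV_continuous[OF cont(2)] bounded_linear_of_real]
    by (simp add: o_def)
  then show "((\<lambda>T. 1 / (2 * T) * integral {-T..T} k) \<longlongrightarrow> \<kappa>) at_top"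
    using tendsto_Re[OF mean(2)[unfolded has_mean_def]] by simp
  show "eventually (\<lambda>T. norm (of_real (1 / (2 * T)) * integral {-T..T} v) \<le> 1 / (2 * T) * integral {-T..T} k) at_top"
    using eventually_gt_at_top[of 0]
  proof eventually_elim
    case (elim T)
    have "norm (integral {-T..T} v) \<le> integral {-T..T} k"
      by (intro integral_norm_bound_integral integrable_UNIV_continuous cont le)
    then show ?case
      using elim by (simp add: norm_mult norm_divide divide_right_mono)
  qed
qed

section \<open>Closure properties of trigonometric polynomials and almost periodic functions\<close>

lemma trig_polynomial_iff:
  "trig_polynomial p \<longleftrightarrow> (\<exists>A c. finite A \<and> p = (\<lambda>t. \<Sum>\<alpha>\<in>A. c \<alpha> * cis (- \<alpha> * t)))"
  by (simp add: trig_polynomial_def cis_conv_exp mult.assoc)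

lemma trig_polynomial_shift:
  assumes "trig_polynomial p"
  shows "trig_polynomial (\<lambda>t. p (t + a))"
proof -
  obtain A c where A: "finite A" "p = (\<lambda>t. \<Sum>\<alpha>\<in>A. c \<alpha> * cis (- \<alpha> * t))"
    using assms unfolding trig_polynomial_iff by blast
  have "(\<lambda>t. p (t + a)) = (\<lambda>t. \<Sum>\<alpha>\<in>A. (c \<alpha> * cis (- \<alpha> * a)) * cis (- \<alpha> * t))"
    by (simp add: A cis_mult distrib_left mult.assoc add.commute)
  then show ?thesis
    unfolding trig_polynomial_iff using A(1) by (intro exI conjI)
qed

lemma trig_polynomial_diff:
  assumes "trig_polynomial p" "trig_polynomial q"
  shows "trig_polynomial (\<lambda>t. p t - q t)"
proof -
  obtain A c where A: "finite A" "p = (\<lambda>t. \<Sum>\<alpha>\<in>A. c \<alpha> * cis (- \<alpha> * t))"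
    using assms(1) unfolding trig_polynomial_iff by blast
  obtain B d where B: "finite B" "q = (\<lambda>t. \<Sum>\<alpha>\<in>B. d \<alpha> * cis (- \<alpha> * t))"
    using assms(2) unfolding trig_polynomial_iff by blast
  \<comment> \<open>Both sums are padded with zero coefficients to a common frequency set.\<close>
  have *: "(\<Sum>\<alpha>\<in>A. f \<alpha>) = (\<Sum>\<alpha>\<in>A \<union> B. if \<alpha> \<in> A then f \<alpha> else 0)"
    "(\<Sum>\<alpha>\<in>B. f \<alpha>) = (\<Sum>\<alpha>\<in>A \<union> B. if \<alpha> \<in> B then f \<alpha> else 0)" for f :: "real \<Rightarrow> complex"
    using A(1) B(1) by (auto simp: sum.If_cases Int_absorb1 Int_absorb2)
  have "(\<lambda>t. p t - q t) = (\<lambda>t. \<Sum>\<alpha>\<in>A \<union> B.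
      ((if \<alpha> \<in> A then c \<alpha> else 0) - (if \<alpha> \<in> B then d \<alpha> else 0)) * cis (- \<alpha> * t))"
    unfolding A(2) B(2) * sum_subtractf[symmetric]
    by (intro ext sum.cong) (auto simp: left_diff_distrib)
  then show ?thesis
    unfolding trig_polynomial_iff using A(1) B(1) by (intro exI conjI) auto
qed

lemma uniformly_almost_periodic_shift:
  assumes "uniformly_almost_periodic g"
  shows "uniformly_almost_periodic (\<lambda>t. g (t + a))"
proof -
  obtain P where P: "\<And>k. trig_polynomial (P k)" "uniform_limit UNIV P g sequentially"
    using assms unfolding uniformly_almost_periodic_def by blast
  have "uniform_limit UNIV (\<lambda>k t. P k (t + a)) (\<lambda>t. g (t + a)) sequentially"
    using uniform_limit_compose'[OF P(2), of "\<lambda>t. t + a" UNIV] by auto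
  then show ?thesis
    unfolding uniformly_almost_periodic_def
    using trig_polynomial_shift[OF P(1)] by (intro exI[of _ "\<lambda>k t. P k (t + a)"]) auto
qed

lemma uniformly_almost_periodic_diff:
  assumes "uniformly_almost_periodic g" "uniformly_almost_periodic h"
  shows "uniformly_almost_periodic (\<lambda>t. g t - h t)"
proof -
  obtain P Q where "\<And>k. trig_polynomial (P k)" "uniform_limit UNIV P g sequentially"
    "\<And>k. trig_polynomial (Q k)" "uniform_limit UNIV Q h sequentially"
    using assms unfolding uniformly_almost_periodic_def by blast
  then show ?thesis
    unfolding uniformly_almost_periodic_def
    by (intro exI[of _ "\<lambda>k t. P k t - Q k t"] conjI allI trig_polynomial_diff uniform_limit_intros)
qed

section \<open>Recovering values from Bochner--Fejer means\<close>

text \<open>The Fejer factor of \<open>\<alpha>\<close> controls only the square of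
  \<open>norm (1 - cis (- \<alpha> * t))\<close>. The inequality of arithmetic and geometric means
  trades the first power for a constant \<open>1 / p\<close> and the square with weight
  \<open>p / 4\<close>; order \<open>p\<^sup>2\<close> makes both contributions of size
  \<open>1 / p\<close>.\<close>

lemma norm_one_minus_cis_fejer_prod_le:
  assumes "finite A" "\<alpha> \<in> A" "p > 0"
  shows "norm (1 - cis (- \<alpha> * t)) * fejer_prod (p\<^sup>2) A t \<le>
     (fejer_prod (p\<^sup>2) A t + fejer_prod (p\<^sup>2) (A - {\<alpha>}) t) / p"
proof -
  let ?x = "norm (1 - cis (- \<alpha> * t))" and ?K = "fejer_prod (p\<^sup>2) A t"
    and ?L = "fejer_prod (p\<^sup>2) (A - {\<alpha>}) t" and ?F = "fejer (p\<^sup>2) (\<alpha> * t)"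
  have x: "?x = norm (1 - cis (\<alpha> * t))"
    by (metis cis_cnj complex_cnj_diff complex_cnj_one complex_mod_cnj minus_mult_left)
  have K: "?K = ?L * ?F"
    using fejer_prod_insert[of "A - {\<alpha>}" \<alpha>] assms by (simp add: insert_absorb)
  \<comment> \<open>The weights balance at \<open>?x = 2 / p\<close>.\<close>
  have "0 \<le> (?x * p - 2)\<^sup>2" by simp
  then have "?x \<le> 1 / p + ?x\<^sup>2 * (p / 4)"
    using \<open>p > 0\<close> by (simp add: power2_eq_square field_simps)
  then have "?x * ?K \<le> (1 / p + ?x\<^sup>2 * (p / 4)) * ?K"
    by (intro mult_right_mono fejer_prod_nonneg)
  also have "\<dots> = ?K / p + (p / 4) * ?L * (?x\<^sup>2 * ?F)"
    by (simp add: K algebra_simps)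
  also have "\<dots> \<le> ?K / p + (p / 4) * ?L * (4 / real (p\<^sup>2))"
    unfolding x by (intro add_left_mono mult_left_mono norm_one_minus_cis_sq_fejer_le
      mult_nonneg_nonneg fejer_prod_nonneg) auto
  also have "\<dots> = (?K + ?L) / p"
    using \<open>p > 0\<close> by (simp add: power2_eq_square field_simps)
  finally show ?thesis .
qed

text \<open>Since \<open>u\<close> times the kernel has mean 0, the mean of \<open>P 0 - u t\<close>
  times the kernel is \<open>P 0\<close> times the kernel mean. Pointwise, \<open>P 0 - u t\<close>
  splits into \<open>P 0 - P t\<close>, which the kernel suppresses near-uniformly by
  \<open>1 / p\<close>, and an error of size \<open>e\<close>.\<close>

lemma norm_trig_polynomial_at_zero_le:
  assumes "finite A" and P: "\<And>t. P t = (\<Sum>\<alpha>\<in>A. c \<alpha> * cis (- \<alpha> * t))"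
    and u: "continuous_on UNIV u" "\<And>\<beta>. has_mean (\<lambda>t. u t * cis (\<beta> * t)) 0"
    and e: "\<And>t. norm (P t - u t) \<le> e" and "p > 0"
  shows "norm (P 0) \<le> 2 * (\<Sum>\<alpha>\<in>A. norm (c \<alpha>)) / real p + e"
proof -
  let ?C = "\<Sum>\<alpha>\<in>A. norm (c \<alpha>)"
  let ?K = "fejer_prod (p\<^sup>2) A" and ?L = "\<lambda>\<alpha>. fejer_prod (p\<^sup>2) (A - {\<alpha>})"
  obtain M M' where M: "M \<ge> 1" "\<And>\<alpha>. \<alpha> \<in> A \<Longrightarrow> M' \<alpha> \<le> M"
    "has_mean (\<lambda>t. of_real (?K t)) (complex_of_real M)"
    "\<And>\<alpha>. \<alpha> \<in> A \<Longrightarrow> has_mean (\<lambda>t. of_real (?L \<alpha> t)) (complex_of_real (M' \<alpha>))"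
    using has_mean_fejer_prod_remove[OF \<open>finite A\<close>, of "p\<^sup>2"] \<open>p > 0\<close> by auto
  \<comment> \<open>\<open>?k\<close> is the pointwise majorant of the product with the kernel, and
    \<open>?\<kappa>\<close> is its mean.\<close>
  let ?k = "\<lambda>t. (?C / p + e) * ?K t + (\<Sum>\<alpha>\<in>A. (norm (c \<alpha>) / p) * ?L \<alpha> t)"
  let ?\<kappa> = "(?C / p + e) * M + (\<Sum>\<alpha>\<in>A. (norm (c \<alpha>) / p) * M' \<alpha>)"
  have "norm (P 0 * M - 0) \<le> ?\<kappa>"
  proof (rule has_mean_norm_le)
    show "continuous_on UNIV (\<lambda>t. P 0 * of_real (?K t) - u t * of_real (?K t))"
      by (intro continuous_intros continuous_on_fejer_prod u)
    show "continuous_on UNIV ?k"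
      by (intro continuous_intros continuous_on_fejer_prod)
    show "has_mean (\<lambda>t. P 0 * of_real (?K t) - u t * of_real (?K t)) (P 0 * M - 0)"
      using has_mean_zero_mult_fejer_prod[OF \<open>finite A\<close> u, of "p\<^sup>2" 0]
      by (intro has_mean_diff has_mean_cmult M continuous_intros continuous_on_fejer_prod u) simp
    have "has_mean (\<lambda>t. complex_of_real (?C / p + e) * of_real (?K t) +
        (\<Sum>\<alpha>\<in>A. complex_of_real (norm (c \<alpha>) / p) * of_real (?L \<alpha> t)))
        (complex_of_real (?C / p + e) * of_real M +
          (\<Sum>\<alpha>\<in>A. complex_of_real (norm (c \<alpha>) / p) * of_real (M' \<alpha>)))"
      by (intro has_mean_add has_mean_sum has_mean_cmult M continuous_intros
          continuous_on_fejer_prod \<open>finite A\<close>)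
    then show "has_mean (\<lambda>t. complex_of_real (?k t)) (complex_of_real ?\<kappa>)"
      by simp
    fix t
    have "norm (P 0 - P t) = norm (\<Sum>\<alpha>\<in>A. c \<alpha> * (1 - cis (- \<alpha> * t)))"
      by (simp add: P sum_subtractf[symmetric] right_diff_distrib)
    also have "\<dots> \<le> (\<Sum>\<alpha>\<in>A. norm (c \<alpha>) * norm (1 - cis (- \<alpha> * t)))"
      by (rule order_trans[OF norm_sum]) (simp add: norm_mult)
    finally have 1: "norm (P 0 - P t) \<le> \<dots>" .
    have "norm (P 0 - u t) \<le> norm (P 0 - P t) + e"
      using norm_triangle_ineq[of "P 0 - P t" "P t - u t"] e[of t] by simp
    then have "norm (P 0 - u t) * ?K t \<le>
        ((\<Sum>\<alpha>\<in>A. norm (c \<alpha>) * norm (1 - cis (- \<alpha> * t))) + e) * ?K t"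
      using 1 by (intro mult_right_mono fejer_prod_nonneg) auto
    also have "\<dots> = (\<Sum>\<alpha>\<in>A. norm (c \<alpha>) * (norm (1 - cis (- \<alpha> * t)) * ?K t)) + e * ?K t"
      by (simp add: distrib_right sum_distrib_right mult.assoc)
    also have "\<dots> \<le> (\<Sum>\<alpha>\<in>A. norm (c \<alpha>) * ((?K t + ?L \<alpha> t) / p)) + e * ?K t"
      by (intro add_right_mono sum_mono mult_left_mono norm_one_minus_cis_fejer_prod_le
          \<open>finite A\<close> \<open>p > 0\<close>) auto
    also have "\<dots> = ?k t"
      by (simp add: distrib_left distrib_right add_divide_distrib sum.distrib sum_distrib_right sum_divide_distrib)
    finally show "norm (P 0 * of_real (?K t) - u t * of_real (?K t)) \<le> ?k t"
      using fejer_prod_nonneg[of "p\<^sup>2" A t]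
      by (simp add: left_diff_distrib[symmetric] norm_mult)
  qed
  \<comment> \<open>With \<open>M' \<alpha> \<le> M\<close> everything becomes a multiple of
    \<open>M\<close>, which cancels because \<open>M \<ge> 1\<close>. The kernels with and without
    the factor of \<open>\<alpha>\<close> together give the 2.\<close>
  also have "\<dots> \<le> (?C / p + e) * M + (\<Sum>\<alpha>\<in>A. (norm (c \<alpha>) / p) * M)"
    by (intro add_left_mono sum_mono mult_left_mono M) auto
  also have "\<dots> = (2 * ?C / p + e) * M"
    unfolding sum_distrib_right[symmetric] sum_divide_distrib[symmetric]
    by (simp add: algebra_simps)
  finally show ?thesis
    using M(1) by (simp add: norm_mult)
qed

lemma uniformly_almost_periodic_zero_at_zero:
  assumes u: "continuous_on UNIV u" "\<And>\<beta>. has_mean (\<lambda>t. u t * cis (\<beta> * t)) 0"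
    and uap: "uniformly_almost_periodic u"
  shows "u 0 = 0"
proof -
  have "norm (u 0) \<le> 0 + e" if e: "e > 0" for e
  proof -
    obtain Q where Q: "\<And>k. trig_polynomial (Q k)" "uniform_limit UNIV Q u sequentially"
      using uap unfolding uniformly_almost_periodic_def by blast
    have "eventually (\<lambda>k. \<forall>t\<in>UNIV. dist (Q k t) (u t) < e / 2) sequentially"
      using Q(2) e by (intro uniform_limitD) auto
    then obtain k where "\<And>t. dist (Q k t) (u t) < e / 2"
      by (metis (lifting) UNIV_I eventually_sequentially order_refl)
    then have k: "norm (Q k t - u t) \<le> e / 2" for t
      by (simp add: dist_norm less_imp_le)
    obtain A c where A: "finite A" "Q k = (\<lambda>t. \<Sum>\<alpha>\<in>A. c \<alpha> * cis (- \<alpha> * t))"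
      using Q(1)[of k] unfolding trig_polynomial_iff by blast
    \<comment> \<open>The coefficient sum depends on \<open>k\<close>, so the approximant is fixed
      first and then \<open>p\<close> tends to infinity.\<close>
    have "norm (Q k 0) \<le> e / 2"
    proof (rule tendsto_lowerbound)
      have "(\<lambda>p. 2 * (\<Sum>\<alpha>\<in>A. norm (c \<alpha>)) / real p + e / 2) \<longlonglongrightarrow> 0 + e / 2"
        by (intro tendsto_intros lim_const_over_n)
      then show "(\<lambda>p. 2 * (\<Sum>\<alpha>\<in>A. norm (c \<alpha>)) / real p + e / 2) \<longlonglongrightarrow> e / 2" by simp
      show "eventually (\<lambda>p. norm (Q k 0) \<le> 2 * (\<Sum>\<alpha>\<in>A. norm (c \<alpha>)) / real p + e / 2) sequentially"
        using eventually_gt_at_top[of 0]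
        by eventually_elim (rule norm_trig_polynomial_at_zero_le[OF A(1) _ u k], simp_all add: A(2))
    qed simp
    then show ?thesis
      using k[of 0] norm_triangle_ineq4[of "Q k 0" "Q k 0 - u 0"] by simp
  qed
  then have "norm (u 0) \<le> 0" by (rule field_le_epsilon)
  then show ?thesis by simp
qed

text \<open>Translation moves \<open>a\<close> to 0 and multiplies each Bohr coefficient by a
  unimodular constant, so all of them still vanish.\<close>

lemma uniformly_almost_periodic_eq_zero:
  assumes u: "continuous_on UNIV u" "\<And>\<beta>. has_mean (\<lambda>t. u t * cis (\<beta> * t)) 0"
    and uap: "uniformly_almost_periodic u" and B: "\<And>t. norm (u t) \<le> B"
  shows "u a = 0"
proof -
  have cont: "continuous_on UNIV (\<lambda>t. u (t + a))"
    by (intro continuous_on_compose2[OF u(1)] continuous_intros) auto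
  have "has_mean (\<lambda>t. u (t + a) * cis (\<beta> * t)) 0" for \<beta>
  proof -
    have "has_mean (\<lambda>t. cis (- \<beta> * a) * (u (t + a) * cis (\<beta> * (t + a)))) (cis (- \<beta> * a) * 0)"
      by (intro has_mean_cmult has_mean_shift[where v = "\<lambda>t. u t * cis (\<beta> * t)" and B = B]
          continuous_intros u) (simp add: norm_mult B)
    moreover have *: "cis (- \<beta> * a) * (u (t + a) * cis (\<beta> * (t + a))) = u (t + a) * cis (\<beta> * t)" for t
      by (simp add: cis_mult algebra_simps)
    ultimately show ?thesis unfolding * by simp
  qed
  from uniformly_almost_periodic_zero_at_zero[OF cont this uniformly_almost_periodic_shift[OF uap]]
  show ?thesis by simp
qed

lemma periodic_of_bohr_coeffs:
  assumes g: "continuous_on UNIV g" "\<And>t. norm (g t) \<le> B" "uniformly_almost_periodic g"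
    and coeff: "\<And>x. x \<notin> \<int> \<Longrightarrow> has_mean (\<lambda>t. g t * cis (x * t)) 0"
  shows "g (t + 2 * pi) = g t"
proof -
  have cont: "continuous_on UNIV (\<lambda>t. g (t + 2 * pi))"
    by (intro continuous_on_compose2[OF g(1)] continuous_intros) auto
  have "has_mean (\<lambda>t. (g (t + 2 * pi) - g t) * cis (x * t)) 0" for x
  proof -
    define v where "v = (\<lambda>t. g t * cis (x * t))"
    have v: "continuous_on UNIV v" "\<And>t. norm (v t) \<le> B"
      unfolding v_def by (auto intro!: continuous_intros g simp: norm_mult)
    have v': "continuous_on UNIV (\<lambda>t. v (t + 2 * pi))"
      by (intro continuous_on_compose2[OF v(1)] continuous_intros) auto
    have eq: "(g (t + 2 * pi) - g t) * cis (x * t) = cis (- x * (2 * pi)) * v (t + 2 * pi) - v t" for t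
      by (simp add: v_def cis_mult algebra_simps)
    show ?thesis
    proof (cases "x \<in> \<int>")
      case True
      \<comment> \<open>The coefficient of \<open>g\<close> at \<open>x\<close> is not known to
        exist here. The translation factor is 1, so boundedness alone gives the difference mean
        0.\<close>
      then obtain n where "x = of_int n" by (auto elim: Ints_cases)
      then have "cis (- x * (2 * pi)) = 1"
        using cis_multiple_2pi[of "- x"] by (simp add: mult_ac)
      then show ?thesis
        unfolding eq using has_mean_shift_diff[OF v, of "2 * pi"] by simp
    next
      case False
      then have "has_mean v 0"
        unfolding v_def by (rule coeff)
      then have "has_mean (\<lambda>t. cis (- x * (2 * pi)) * v (t + 2 * pi) - v t) (cis (- x * (2 * pi)) * 0 - 0)"
        by (intro has_mean_diff has_mean_cmult has_mean_shift[OF v] continuous_intros v v')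
      then show ?thesis
        unfolding eq by simp
    qed
  qed
  moreover have "norm (g (t + 2 * pi) - g t) \<le> B + B" for t
    by (intro order_trans[OF norm_triangle_ineq4] add_mono g)
  ultimately have "g (t + 2 * pi) - g t = 0"
    by (intro uniformly_almost_periodic_eq_zero[where u = "\<lambda>t. g (t + 2 * pi) - g t" and B = "B + B"]
      uniformly_almost_periodic_diff uniformly_almost_periodic_shift g cont continuous_on_diff)
  then show ?thesis by simp
qed

section \<open>Periodic functions on the half-plane\<close>

lemma open_right_half_plane: "open (right_half_plane \<sigma>)"
  unfolding right_half_plane_def by (rule open_halfspace_Re_gt)

lemma periodic_eq_if_exp_eq:
  assumes per: "\<And>s. s \<in> right_half_plane 0 \<Longrightarrow> f (s + 2 * of_real pi * \<i>) = f s"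
    and "w \<in> right_half_plane 0" "exp w = exp z"
  shows "f w = f z"
proof -
  have nat: "f (s + of_nat n * (2 * of_real pi * \<i>)) = f s" if "s \<in> right_half_plane 0" for s n
  proof (induction n)
    case (Suc n)
    have "s + of_nat n * (2 * of_real pi * \<i>) \<in> right_half_plane 0"
      using that by (simp add: right_half_plane_def)
    from per[OF this] Suc show ?case by (simp add: algebra_simps)
  qed simp
  obtain n where n: "w = z + (of_int (2 * n) * pi) * \<i>"
    using assms(3) by (auto simp: exp_eq)
  have z: "z \<in> right_half_plane 0"
    using assms(2) n by (simp add: right_half_plane_def)
  \<comment> \<open>\<open>nat\<close> adds periods upwards only, so the argument starts from the
    lower of the two points.\<close>
  show ?thesis
  proof (cases "n \<ge> 0")
    case True
    then have "w = z + of_nat (nat n) * (2 * of_real pi * \<i>)"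
      using n by (simp add: mult_ac)
    then show ?thesis using nat[OF z] by simp
  next
    case False
    then have "z = w + of_nat (nat (- n)) * (2 * of_real pi * \<i>)"
      using n by (simp add: mult_ac)
    then show ?thesis using nat[OF assms(2)] by metis
  qed
qed

section \<open>Transfer to the unit disc\<close>

lemma neg_Ln_in_right_half_plane:
  "z \<in> ball 0 1 - {0} \<Longrightarrow> - Ln z \<in> right_half_plane 0"
  by (simp add: right_half_plane_def)

text \<open>Near the negative real axis, periodicity allows replacing the principal logarithm by
  the branch \<open>Ln (- z) - \<i> \<pi>\<close>, which is holomorphic there.\<close>

lemma periodic_neg_Ln_holomorphic:
  assumes hol: "f holomorphic_on right_half_plane 0"
    and per: "\<And>s. s \<in> right_half_plane 0 \<Longrightarrow> f (s + 2 * of_real pi * \<i>) = f s"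
  shows "(\<lambda>z. f (- Ln z)) holomorphic_on (ball 0 1 - {0})"
proof -
  let ?U = "ball 0 1 - \<real>\<^sub>\<le>\<^sub>0 :: complex set" and ?V = "ball 0 1 - \<real>\<^sub>\<ge>\<^sub>0 :: complex set"
  have U: "z \<noteq> 0" if "z \<in> ?U" for z using that by auto
  have V: "z \<noteq> 0" if "z \<in> ?V" for z using that by auto
  have "(f \<circ> (\<lambda>z. - Ln z)) holomorphic_on ?U"
    using U neg_Ln_in_right_half_plane
    by (intro holomorphic_on_compose_gen[OF _ hol] holomorphic_intros) auto
  moreover have "(f \<circ> (\<lambda>z. - Ln (- z) + of_real pi * \<i>)) holomorphic_on ?V"
  proof (rule holomorphic_on_compose_gen[OF _ hol])
    show "(\<lambda>z. - Ln (- z) + of_real pi * \<i>) holomorphic_on ?V"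
      by (intro holomorphic_intros) (auto simp: complex_nonpos_Reals_iff complex_nonneg_Reals_iff)
    show "(\<lambda>z. - Ln (- z) + of_real pi * \<i>) ` ?V \<subseteq> right_half_plane 0"
      using V by (auto simp: right_half_plane_def)
  qed
  then have "(f \<circ> (\<lambda>z. - Ln z)) holomorphic_on ?V"
  proof (rule holomorphic_transform)
    fix z assume z: "z \<in> ?V"
    \<comment> \<open>Both arguments are logarithms of \<open>1 / z\<close>, so the periodic
      \<open>f\<close> agrees on them.\<close>
    have "exp (- Ln (- z) + of_real pi * \<i>) = exp (- Ln z)"
      using V[OF z] by (simp add: exp_diff exp_minus divide_inverse)
    moreover have "- Ln z \<in> right_half_plane 0"
      using V[OF z] z by (intro neg_Ln_in_right_half_plane) auto
    ultimately show "(f \<circ> (\<lambda>z. - Ln (- z) + of_real pi * \<i>)) z = (f \<circ> (\<lambda>z. - Ln z)) z"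
      using periodic_eq_if_exp_eq[where f = f, OF per] by (metis comp_apply)
  qed
  ultimately have "(f \<circ> (\<lambda>z. - Ln z)) holomorphic_on (?U \<union> ?V)"
    by (intro holomorphic_on_Un open_Diff) auto
  moreover have "?U \<union> ?V = ball 0 1 - {0}"
    by (auto simp: complex_nonpos_Reals_iff complex_nonneg_Reals_iff complex_eq_iff)
  ultimately show ?thesis by (simp add: o_def)
qed

text \<open>The \<open>b n\<close> are the Taylor coefficients at 0 of the extension of
  \<open>f (- Ln z)\<close> across the puncture. A general growth order \<open>l\<close> lets the
  lemma serve both spaces.\<close>

lemma periodic_power_series:
  assumes hol: "f holomorphic_on right_half_plane 0"
    and per: "\<And>s. s \<in> right_half_plane 0 \<Longrightarrow> f (s + 2 * of_real pi * \<i>) = f s"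
    and bound: "\<And>s. s \<in> right_half_plane 0 \<Longrightarrow> norm (f s) \<le> C * (1 + norm s) powr l"
    and l: "l \<ge> 0"
  obtains b where "\<And>s. s \<in> right_half_plane 0 \<Longrightarrow> (\<lambda>n. b n * exp (- s) ^ n) sums f s"
    and "bounded (f ` right_half_plane 0)"
proof -
  let ?F = "\<lambda>z. f (- Ln z)"
  have F_eq: "?F (exp (- s)) = f s" if "s \<in> right_half_plane 0" for s
  proof -
    have "exp s = exp (- Ln (exp (- s)))"
      by (metis exp_Ln exp_minus exp_not_eq_zero inverse_inverse_eq)
    then show ?thesis
      using periodic_eq_if_exp_eq[where f = f, OF per that] by simp
  qed
  have C: "C \<ge> 0"
  proof -
    have "0 \<le> norm (f 1)" by simp
    also have "\<dots> \<le> C * 2 powr l"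
      using bound[of 1] by (simp add: right_half_plane_def)
    finally show ?thesis by (simp add: zero_le_mult_iff)
  qed
  have F_bound: "norm (?F z) \<le> C * (1 + pi - ln (norm z)) powr l" if "z \<in> ball 0 1 - {0}" for z
  proof -
    \<comment> \<open>The principal logarithm has imaginary part at most \<open>pi\<close> in
      modulus, so only \<open>ln (norm z)\<close> can make it grow.\<close>
    have "norm (Ln z) \<le> \<bar>Re (Ln z)\<bar> + \<bar>Im (Ln z)\<bar>" by (rule cmod_le)
    also have "\<dots> \<le> - ln (norm z) + pi"
      using that mpi_less_Im_Ln[of z] Im_Ln_le_pi[of z] by simp
    finally have "(1 + norm (Ln z)) powr l \<le> (1 + pi - ln (norm z)) powr l"
      using l by (intro powr_mono2) auto
    then have "C * (1 + norm (Ln z)) powr l \<le> C * (1 + pi - ln (norm z)) powr l"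
      by (rule mult_left_mono[OF _ C])
    then show ?thesis
      using bound[OF neg_Ln_in_right_half_plane[OF that]] by simp
  qed
  \<comment> \<open>One factor \<open>z\<close> beats every power of the logarithm; this limit is
    Riemann's criterion for a removable singularity.\<close>
  have "((\<lambda>z. (z - 0) * ?F z) \<longlongrightarrow> 0) (at 0)"
  proof (rule Lim_null_comparison)
    show "eventually (\<lambda>z. norm ((z - 0) * ?F z) \<le> norm z * (C * (1 + pi - ln (norm z)) powr l)) (at 0)"
      unfolding eventually_at
    proof (intro exI[of _ 1] conjI ballI impI)
      fix z :: complex assume "z \<noteq> 0 \<and> dist z 0 < 1"
      then show "norm ((z - 0) * ?F z) \<le> norm z * (C * (1 + pi - ln (norm z)) powr l)"
        using mult_left_mono[OF F_bound[of z], of "norm z"] by (simp add: norm_mult)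
    qed simp
    have lim: "((\<lambda>r::real. r * (C * (1 + pi - ln r) powr l)) \<longlongrightarrow> 0) (at_right 0)"
      by real_asymp
    have "filterlim norm (at_right 0) (at (0::complex))"
      by (auto simp: filterlim_at eventually_at_filter intro!: tendsto_norm_zero)
    from filterlim_compose[OF lim this]
    show "((\<lambda>z. norm z * (C * (1 + pi - ln (norm z)) powr l)) \<longlongrightarrow> 0) (at (0::complex))" .
  qed
  then obtain G where G: "G holomorphic_on ball 0 1" "\<And>z. z \<in> ball 0 1 - {0} \<Longrightarrow> G z = ?F z"
    using holomorphic_on_extend_lim[OF periodic_neg_Ln_holomorphic[OF hol per]] by auto
  have exp_in: "exp (- s) \<in> ball 0 1 - {0}" if "s \<in> right_half_plane 0" for s
    using that by (simp add: right_half_plane_def)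
  have G_eq: "G (exp (- s)) = f s" if "s \<in> right_half_plane 0" for s
    using G(2)[OF exp_in[OF that]] F_eq[OF that] by simp
  have "(\<lambda>n. (deriv ^^ n) G 0 / fact n * exp (- s) ^ n) sums f s" if "s \<in> right_half_plane 0" for s
    using holomorphic_power_series[OF G(1), of "exp (- s)"] exp_in[OF that] G_eq[OF that] by simp
  moreover have "bounded (f ` right_half_plane 0)"
  proof -
    have "cball 0 (exp (- 1)) \<subseteq> ball (0::complex) 1"
      using exp_less_one_iff[of "- 1 :: real"] by (auto simp del: exp_less_one_iff)
    then have "compact (G ` cball 0 (exp (- 1)))"
      by (intro compact_continuous_image continuous_on_subset[OF holomorphic_on_imp_continuous_on[OF G(1)]])
         auto
    then obtain B where "\<forall>w \<in> G ` cball 0 (exp (- 1)). norm w \<le> B"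
      using bounded_iff[THEN iffD1, OF compact_imp_bounded] by blast
    then have B: "norm (G z) \<le> B" if "norm z \<le> exp (- 1)" for z
      using that by simp
    \<comment> \<open>The radius \<open>exp (- 1)\<close> corresponds to \<open>Re s = 1\<close>:
      compactness of the smaller disc covers \<open>Re s \<ge> 1\<close>. For
      \<open>0 < Re s < 1\<close> the growth bound applies, since
      \<open>- ln (norm (exp (- s)))\<close> equals \<open>Re s\<close>.\<close>
    have "norm (f s) \<le> max B (C * (2 + pi) powr l)" if s: "s \<in> right_half_plane 0" for s
    proof (cases "Re s \<ge> 1")
      case True
      then have "norm (G (exp (- s))) \<le> B" by (intro B) simp
      then show ?thesis unfolding G_eq[OF s] by simp
    next
      case False
      have "norm (f s) \<le> C * (1 + pi - ln (norm (exp (- s)))) powr l"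
        using F_bound[OF exp_in[OF s]] F_eq[OF s] by simp
      also have "\<dots> \<le> C * (2 + pi) powr l"
        using False s C l pi_gt_zero
        by (intro mult_left_mono powr_mono2) (auto simp: right_half_plane_def)
      finally show ?thesis by simp
    qed
    then show ?thesis unfolding bounded_iff by blast
  qed
  ultimately show ?thesis by (rule that)
qed

section \<open>Power series in \<open>exp (- s)\<close> on vertical lines\<close>

text \<open>Convergence at \<open>\<sigma> / 2\<close> gives absolute convergence at
  \<open>\<sigma>\<close>, and the moduli of the terms are constant along the line. The factor
  \<open>cis (x * t)\<close> covers Bohr coefficients too; \<open>x = 0\<close> gives almost
  periodicity.\<close>

lemma vertical_line_uniform_limit:
  assumes sums: "\<And>s. s \<in> right_half_plane 0 \<Longrightarrow> (\<lambda>n. b n * exp (- s) ^ n) sums f s"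
    and "\<sigma> > 0"
  shows "uniform_limit UNIV
     (\<lambda>N t. \<Sum>n<N. b n * of_real (exp (- \<sigma>)) ^ n * cis ((x - real n) * t))
     (\<lambda>t. f (Complex \<sigma> t) * cis (x * t)) sequentially"
proof -
  let ?f = "\<lambda>n t. b n * of_real (exp (- \<sigma>)) ^ n * cis ((x - real n) * t)"
  have "summable (\<lambda>n. b n * exp (- complex_of_real (\<sigma> / 2)) ^ n)"
    using sums[of "of_real (\<sigma> / 2)"] \<open>\<sigma> > 0\<close> by (auto simp: right_half_plane_def summable_def)
  then have "summable (\<lambda>n. norm (b n * complex_of_real (exp (- \<sigma>)) ^ n))"
    by (rule powser_insidea) (use \<open>\<sigma> > 0\<close> in \<open>simp add: norm_exp_eq_Re\<close>)
  then have "uniform_limit UNIV (\<lambda>N t. \<Sum>n<N. ?f n t) (\<lambda>t. suminf (\<lambda>n. ?f n t)) sequentially"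
    by (intro Weierstrass_m_test) (simp_all add: norm_mult)
  moreover have "suminf (\<lambda>n. ?f n t) = f (Complex \<sigma> t) * cis (x * t)" for t
  proof -
    have "exp (- Complex \<sigma> t) ^ n = of_real (exp (- \<sigma>)) ^ n * cis (- real n * t)" for n
    proof -
      have "exp (- Complex \<sigma> t) = of_real (exp (- \<sigma>)) * cis (- t)"
        by (simp add: exp_eq_polar)
      then show ?thesis by (simp add: power_mult_distrib Complex.DeMoivre)
    qed
    then have *: "?f n t = b n * exp (- Complex \<sigma> t) ^ n * cis (x * t)" for n
      by (simp add: cis_mult algebra_simps)
    then show ?thesis
      unfolding * using sums_unique[OF sums_mult2[OF sums[of "Complex \<sigma> t"], of "cis (x * t)"]] \<open>\<sigma> > 0\<close>
      by (simp add: right_half_plane_def)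
  qed
  ultimately show ?thesis by simp
qed

lemma power_series_uniformly_almost_periodic:
  assumes sums: "\<And>s. s \<in> right_half_plane 0 \<Longrightarrow> (\<lambda>n. b n * exp (- s) ^ n) sums f s"
    and "\<sigma> > 0"
  shows "uniformly_almost_periodic (\<lambda>t. f (Complex \<sigma> t))"
  unfolding uniformly_almost_periodic_def
proof (intro exI conjI allI)
  show "uniform_limit UNIV (\<lambda>N t. \<Sum>n<N. b n * of_real (exp (- \<sigma>)) ^ n * cis (- real n * t))
      (\<lambda>t. f (Complex \<sigma> t)) sequentially"
    using vertical_line_uniform_limit[OF assms, of 0] by simp
  fix N :: nat
  \<comment> \<open>\<open>trig_polynomial\<close> indexes by real frequencies, so the coefficient
    index is recovered by rounding down.\<close>
  have "(\<Sum>n<N. b n * of_real (exp (- \<sigma>)) ^ n * cis (- real n * t)) =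
      (\<Sum>\<alpha>\<in>real ` {..<N}. (b (nat \<lfloor>\<alpha>\<rfloor>) * of_real (exp (- \<sigma>)) ^ nat \<lfloor>\<alpha>\<rfloor>) * cis (- \<alpha> * t))" for t
    by (subst sum.reindex) (auto simp: inj_on_def)
  then show "trig_polynomial (\<lambda>t. \<Sum>n<N. b n * of_real (exp (- \<sigma>)) ^ n * cis (- real n * t))"
    unfolding trig_polynomial_iff
    by (intro exI[of _ "real ` {..<N}"]
        exI[of _ "\<lambda>\<alpha>. b (nat \<lfloor>\<alpha>\<rfloor>) * of_real (exp (- \<sigma>)) ^ nat \<lfloor>\<alpha>\<rfloor>"]) simp
qed

lemma exp_Complex_mult:
  "exp (Complex \<sigma> t * of_real x) = of_real (exp (\<sigma> * x)) * cis (x * t)"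
  by (subst exp_eq_polar) (simp add: mult.commute)

text \<open>The partial sums on the line involve only the frequencies \<open>x - real n\<close>,
  none of which is 0.\<close>

lemma power_series_has_bohr_coeff_zero:
  assumes sums: "\<And>s. s \<in> right_half_plane 0 \<Longrightarrow> (\<lambda>n. b n * exp (- s) ^ n) sums f s"
    and x: "x \<notin> range real"
  shows "has_bohr_coeff f x 0"
proof -
  have "has_mean (\<lambda>t. f (Complex \<sigma> t) * exp (Complex \<sigma> t * of_real x)) 0" if "\<sigma> > 0" for \<sigma>
  proof -
    have "has_mean (\<lambda>t. f (Complex \<sigma> t) * cis (x * t)) 0"
    proof (rule has_mean_uniform_limit_zero[OF _ _ vertical_line_uniform_limit[OF sums that]])
      fix N :: nat
      have "has_mean (\<lambda>t. cis ((x - real n) * t)) 0" for n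
        using has_mean_cis[of "x - real n"] x by (cases "x = real n") auto
      then have "has_mean (\<lambda>t. \<Sum>n<N. b n * of_real (exp (- \<sigma>)) ^ n * cis ((x - real n) * t))
          (\<Sum>n<N. b n * of_real (exp (- \<sigma>)) ^ n * 0)"
        by (intro has_mean_sum has_mean_cmult continuous_intros) auto
      then show "has_mean (\<lambda>t. \<Sum>n<N. b n * of_real (exp (- \<sigma>)) ^ n * cis ((x - real n) * t)) 0"
        by simp
    qed (auto intro!: continuous_intros)
    from has_mean_cmult[OF this, of "of_real (exp (\<sigma> * x))"] show ?thesis
      unfolding exp_Complex_mult by (simp add: mult_ac)
  qed
  then show ?thesis
    by (simp add: has_bohr_coeff_def has_mean_def)
qed

text \<open>Order \<open>m = 0\<close> and abscissa 0 suffice: the Riesz means are then ordinary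
  partial sums.\<close>

lemma power_series_riesz_germ:
  assumes sums: "\<And>s. s \<in> right_half_plane 0 \<Longrightarrow> (\<lambda>n. b n * exp (- s) ^ n) sums f s"
  shows "riesz_germ real b f"
  unfolding riesz_germ_def
proof (intro exI conjI ballI)
  fix s assume s: "s \<in> right_half_plane 0"
  have "filterlim (\<lambda>x::real. nat \<lceil>x\<rceil>) at_top at_top"
    unfolding filterlim_at_top
  proof
    fix N :: nat
    show "eventually (\<lambda>x::real. N \<le> nat \<lceil>x\<rceil>) at_top"
      using eventually_ge_at_top[of "real N"] by eventually_elim linarith
  qed
  from filterlim_compose[OF sums[OF s, unfolded sums_def] this]
  have "((\<lambda>x::real. \<Sum>n<nat \<lceil>x\<rceil>. b n * exp (- s) ^ n) \<longlongrightarrow> f s) at_top" .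
  moreover have "riesz_mean real b 0 x s = (\<Sum>n<nat \<lceil>x\<rceil>. b n * exp (- s) ^ n)" for x
  proof -
    have "{n. real n < x} = {..<nat \<lceil>x\<rceil>}"
      by (auto simp: less_ceiling_iff zless_nat_eq_int_zless)
    \<comment> \<open>\<open>real n < x\<close> keeps the base positive; this matters because
      \<open>0 powr 0\<close> is 0.\<close>
    moreover have "b n * exp (- of_real (real n) * s) * of_real ((1 - real n / x) powr 0) =
        b n * exp (- s) ^ n" if "real n < x" for n
      using that by (auto simp: exp_of_nat_mult[symmetric] field_simps)
    ultimately show ?thesis
      unfolding riesz_mean_def by (intro sum.cong) auto
  qed
  ultimately show "((\<lambda>x. riesz_mean real b 0 x s) \<longlongrightarrow> f s) at_top" by simp
qed auto

section \<open>Periodicity of the functions in both spaces\<close>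

text \<open>With integer frequencies every Riesz mean is itself periodic, so uniqueness of limits
  makes \<open>f\<close> periodic wherever the means converge to it.\<close>

lemma riesz_germ_imp_periodic:
  assumes hol: "f holomorphic_on right_half_plane 0" and germ: "riesz_germ real a f"
    and s: "s \<in> right_half_plane 0"
  shows "f (s + 2 * of_real pi * \<i>) = f s"
proof -
  obtain m \<sigma> where \<sigma>: "\<sigma> \<ge> 0"
    "\<And>s. s \<in> right_half_plane \<sigma> \<Longrightarrow> ((\<lambda>x. riesz_mean real a m x s) \<longlongrightarrow> f s) at_top"
    using germ unfolding riesz_germ_def by blast
  have shift: "z + 2 * of_real pi * \<i> \<in> right_half_plane \<tau> \<longleftrightarrow> z \<in> right_half_plane \<tau>" for z \<tau>
    by (simp add: right_half_plane_def)
  show ?thesis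
  proof (rule analytic_continuation_open[where f = "\<lambda>s. f (s + 2 * of_real pi * \<i>)"
        and g = f and s = "right_half_plane \<sigma>" and s' = "right_half_plane 0"])
    show "right_half_plane \<sigma> \<noteq> {}"
      by (auto simp: right_half_plane_def intro!: exI[of _ "of_real (\<sigma> + 1)"])
    show "connected (right_half_plane 0)"
      unfolding right_half_plane_def by (rule connected_halfspace_Re_gt)
    show "right_half_plane \<sigma> \<subseteq> right_half_plane 0"
      using \<sigma>(1) by (auto simp: right_half_plane_def)
    show "(\<lambda>s. f (s + 2 * of_real pi * \<i>)) holomorphic_on right_half_plane 0"
      using shift by (intro holomorphic_on_compose_gen[OF _ hol, unfolded o_def] holomorphic_intros) auto
    fix z assume z: "z \<in> right_half_plane \<sigma>"
    have "exp (- of_real (real n) * (z + 2 * of_real pi * \<i>)) = exp (- of_real (real n) * z)" for n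
      unfolding exp_eq by (intro exI[of _ "- int n"]) (simp add: algebra_simps)
    then have "riesz_mean real a m x (z + 2 * of_real pi * \<i>) = riesz_mean real a m x z" for x
      unfolding riesz_mean_def by simp
    then show "f (z + 2 * of_real pi * \<i>) = f z"
      using \<sigma>(2)[of "z + 2 * of_real pi * \<i>"] \<sigma>(2)[OF z] z shift
        tendsto_unique[OF trivial_limit_at_top_linorder] by simp
  qed (use hol s open_right_half_plane in auto)
qed

lemma H_infty_periodic:
  assumes f: "f \<in> H_infty real" and s: "s \<in> right_half_plane 0"
  shows "f (s + 2 * of_real pi * \<i>) = f s"
proof -
  define \<sigma> where "\<sigma> = Re s"
  have \<sigma>: "\<sigma> > 0" using s by (simp add: \<sigma>_def right_half_plane_def)
  have mem: "Complex \<sigma> t \<in> right_half_plane 0" for t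
    using \<sigma> by (simp add: right_half_plane_def)
  obtain B where B: "\<And>z. z \<in> right_half_plane 0 \<Longrightarrow> norm (f z) \<le> B"
    using f unfolding H_infty_def bounded_iff by auto
  have "(\<lambda>t. f (Complex \<sigma> t)) (Im s + 2 * pi) = (\<lambda>t. f (Complex \<sigma> t)) (Im s)"
  proof (rule periodic_of_bohr_coeffs[where B = B])
    have "f holomorphic_on right_half_plane 0" using f by (simp add: H_infty_def)
    then show "continuous_on UNIV (\<lambda>t. f (Complex \<sigma> t))"
      by (rule continuous_on_compose2[OF holomorphic_on_imp_continuous_on])
         (use mem in \<open>auto intro!: continuous_intros simp: Complex_eq\<close>)
    show "norm (f (Complex \<sigma> t)) \<le> B" for t by (rule B[OF mem])
    show "uniformly_almost_periodic (\<lambda>t. f (Complex \<sigma> t))"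
      using f \<sigma> by (simp add: H_infty_def)
    fix x :: real assume "x \<notin> \<int>"
    then have "x \<notin> range real" by auto
    then have "has_bohr_coeff f x 0"
      using f by (simp add: H_infty_def)
    then have "has_mean (\<lambda>t. f (Complex \<sigma> t) * exp (Complex \<sigma> t * of_real x)) 0"
      using \<sigma> by (simp add: has_bohr_coeff_def has_mean_def)
    \<comment> \<open>Along the line the modulus of the exponential is constant, so it can be
      divided out.\<close>
    from has_mean_cmult[OF this, of "of_real (exp (- (\<sigma> * x)))"]
    show "has_mean (\<lambda>t. f (Complex \<sigma> t) * cis (x * t)) 0"
      unfolding exp_Complex_mult by (simp add: exp_minus field_simps)
  qed
  moreover have "Complex \<sigma> (Im s + 2 * pi) = s + 2 * of_real pi * \<i>" "Complex \<sigma> (Im s) = s"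
    by (simp_all add: complex_eq_iff \<sigma>_def)
  ultimately show ?thesis by simp
qed

theorem proposition3p3:
  fixes l :: real
  assumes "l \<ge> 0"
  shows "H_infty (\<lambda>n. real n) = H_infty_ell (\<lambda>n. real n) l"
proof (intro equalityI subsetI)
  fix f assume f: "f \<in> H_infty (\<lambda>n. real n)"
  then have hol: "f holomorphic_on right_half_plane 0" by (simp add: H_infty_def)
  obtain B where B: "\<And>z. z \<in> right_half_plane 0 \<Longrightarrow> norm (f z) \<le> B"
    using f unfolding H_infty_def bounded_iff by auto
  \<comment> \<open>Boundedness is recast as growth of order 0 to fit
    \<open>periodic_power_series\<close>.\<close>
  have B': "norm (f s) \<le> B * (1 + norm s) powr 0" if "s \<in> right_half_plane 0" for s
    using B[OF that] norm_ge_zero[of s] by (simp add: add_nonneg_eq_0_iff)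
  then obtain b where "\<And>s. s \<in> right_half_plane 0 \<Longrightarrow> (\<lambda>n. b n * exp (- s) ^ n) sums f s"
    using periodic_power_series[OF hol H_infty_periodic[OF f] B' order_refl] by blast
  then have "riesz_germ real b f" by (rule power_series_riesz_germ)
  moreover have "norm (f s) / (1 + norm s) powr l \<le> B" if "s \<in> right_half_plane 0" for s
  proof -
    have "norm (f s) / (1 + norm s) powr l \<le> norm (f s) / 1"
      using \<open>l \<ge> 0\<close> norm_ge_zero[of s]
      by (intro divide_left_mono ge_one_powr_ge_zero) (auto simp: add_nonneg_eq_0_iff)
    then show ?thesis using B[OF that] by simp
  qed
  then have "bdd_above ((\<lambda>s. norm (f s) / (1 + norm s) powr l) ` right_half_plane 0)"
    by (auto intro!: bdd_aboveI2)
  ultimately show "f \<in> H_infty_ell (\<lambda>n. real n) l"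
    using hol by (auto simp: H_infty_ell_def)
next
  fix f assume f: "f \<in> H_infty_ell (\<lambda>n. real n) l"
  then have hol: "f holomorphic_on right_half_plane 0" by (simp add: H_infty_ell_def)
  obtain a where a: "riesz_germ real a f"
    using f by (auto simp: H_infty_ell_def)
  have "bdd_above ((\<lambda>s. norm (f s) / (1 + norm s) powr l) ` right_half_plane 0)"
    using f by (simp add: H_infty_ell_def)
  then obtain C where C: "\<And>s. s \<in> right_half_plane 0 \<Longrightarrow> norm (f s) / (1 + norm s) powr l \<le> C"
    unfolding bdd_above_def by auto
  have "norm (f s) \<le> C * (1 + norm s) powr l" if "s \<in> right_half_plane 0" for s
  proof -
    have "1 + norm s > 0" by (smt (verit) norm_ge_zero)
    then show ?thesis using C[OF that] by (simp add: divide_le_eq)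
  qed
  then obtain b where b: "\<And>s. s \<in> right_half_plane 0 \<Longrightarrow> (\<lambda>n. b n * exp (- s) ^ n) sums f s"
    and "bounded (f ` right_half_plane 0)"
    using periodic_power_series[OF hol riesz_germ_imp_periodic[OF hol a] _ \<open>l \<ge> 0\<close>] by blast
  then show "f \<in> H_infty (\<lambda>n. real n)"
    using hol power_series_uniformly_almost_periodic[OF b] power_series_has_bohr_coeff_zero[OF b]
    by (auto simp: H_infty_def)
qed

end
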